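(* Let $0\le m\le n$ be integers, let $d\in\{1,2\}$, and if $d=2$ assume that $n$ and $m$ have the same parity. Let $V$ be the real vector space of polynomials spanned by $\{x^m,x^{m+d},\ldots,x^{n-d},x^n\}$. Let $S$ be a finite set of bases of $V$, each of which is an ascending basis or a descending basis, with $k_1$ ascending bases and $k_2$ descending bases. Consider the groupoid of all change of basis matrices $M_{vt}$, $v,t\in S$ (one morphism for each ordered pair $(v,t)$), with operations matrix inversion and matrix products of the form $M_{vr}M_{rt}=M_{vt}$. Then the change of basis matrices $M_{vt}$ with $v,t\in S$ both ascending form a connected sub-groupoid of order $k_1^2$ consisting of lower-triangular matrices, and the change of basis matrices $M_{vt}$ with $v,t\in S$ both descending form a connected sub-groupoid of order $k_2^2$ consisting of upper-triangular matrices.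
   Context: A descending basis of $V$ is a basis $(p_0,p_1,\ldots,p_N)$, $N=(n-m)/d$, such that $p_j$ has degree $m+jd$ (all $p_j\in V$, so every monomial in $p_j$ has exponent in $\{m,m+d,\ldots,n\}$). An ascending basis of $V$ is a basis $(p_0,\ldots,p_N)$ such that $p_j$ has minimum degree $m+jd$ (the minimum degree is the least exponent occurring with nonzero coefficient). The bases are ordered as indicated: descending bases by increasing degree, ascending bases by increasing minimum degree. The monomial basis is both ascending and descending. For ordered bases $v,t$ of $V$, the change of basis matrix $M_{vt}$ is the matrix whose $j$-th column is the coordinate vector with respect to $v$ of the $j$-th element of $t$. The order of a groupoid is its number of morphisms, where morphisms are indexed by the ordered pairs $(v,t)$; a groupoid is connected if there is a morphism between any two objects. *)

theory Defs
  imports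
    "HOL-Computational_Algebra.Polynomial"
    "Jordan_Normal_Form.Gauss_Jordan_Elimination"
begin

global_interpretation real_poly:
  Vector_Spaces.vector_space "Polynomial.smult :: real \<Rightarrow> real poly \<Rightarrow> real poly"
  by unfold_locales (simp_all add: smult_add_right smult_add_left)

definition poly_space :: "nat \<Rightarrow> nat \<Rightarrow> nat \<Rightarrow> real poly set" where
  "poly_space m n d = real_poly.span {monom 1 (m + j * d) | j. j \<le> (n - m) div d}"

text \<open>The least exponent occurring with nonzero coefficient; meant for nonzero polynomials only.\<close>

definition min_degree :: "real poly \<Rightarrow> nat" where
  "min_degree p = (LEAST i. coeff p i \<noteq> 0)"

definition ordered_basis :: "real poly set \<Rightarrow> real poly list \<Rightarrow> bool" where
  "ordered_basis V v \<longleftrightarrow>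
     distinct v \<and> real_poly.independent (set v) \<and> real_poly.span (set v) = V"

definition descending_basis :: "nat \<Rightarrow> nat \<Rightarrow> nat \<Rightarrow> real poly list \<Rightarrow> bool" where
  "descending_basis m n d v \<longleftrightarrow>
     ordered_basis (poly_space m n d) v \<and> length v = (n - m) div d + 1 \<and>
     (\<forall>j < length v. degree (v ! j) = m + j * d)"

definition ascending_basis :: "nat \<Rightarrow> nat \<Rightarrow> nat \<Rightarrow> real poly list \<Rightarrow> bool" where
  "ascending_basis m n d v \<longleftrightarrow>
     ordered_basis (poly_space m n d) v \<and> length v = (n - m) div d + 1 \<and>
     (\<forall>j < length v. min_degree (v ! j) = m + j * d)"

definition change_of_basis :: "real poly list \<Rightarrow> real poly list \<Rightarrow> real mat" where
  "change_of_basis v t =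
     mat (length v) (length t) (\<lambda>(i, j). real_poly.representation (set v) (t ! j) (v ! i))"

definition lower_triangular :: "'a::zero mat \<Rightarrow> bool" where
  "lower_triangular A \<longleftrightarrow>
     (\<forall>i < dim_row A. \<forall>j < dim_col A. i < j \<longrightarrow> A $$ (i, j) = 0)"

record ('o, 'a) groupoid_data =
  obj :: "'o set"
  arr :: "'a set"
  src :: "'a \<Rightarrow> 'o"
  tgt :: "'a \<Rightarrow> 'o"
  comp :: "'a \<Rightarrow> 'a \<Rightarrow> 'a"
  ident :: "'o \<Rightarrow> 'a"
  invr :: "'a \<Rightarrow> 'a"

text \<open>
  Composition is written in the order of matrix products: \<open>comp G f g\<close> is
  meaningful when \<open>src G f = tgt G g\<close>.
\<close>

locale groupoid =
  fixes G :: "('o, 'a) groupoid_data"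
  assumes src_obj: "f \<in> arr G \<Longrightarrow> src G f \<in> obj G"
    and tgt_obj: "f \<in> arr G \<Longrightarrow> tgt G f \<in> obj G"
    and comp_arr: "\<lbrakk>f \<in> arr G; g \<in> arr G; src G f = tgt G g\<rbrakk> \<Longrightarrow> comp G f g \<in> arr G"
    and src_comp: "\<lbrakk>f \<in> arr G; g \<in> arr G; src G f = tgt G g\<rbrakk> \<Longrightarrow> src G (comp G f g) = src G g"
    and tgt_comp: "\<lbrakk>f \<in> arr G; g \<in> arr G; src G f = tgt G g\<rbrakk> \<Longrightarrow> tgt G (comp G f g) = tgt G f"
    and comp_assoc: "\<lbrakk>f \<in> arr G; g \<in> arr G; h \<in> arr G; src G f = tgt G g; src G g = tgt G h\<rbrakk>
           \<Longrightarrow> comp G (comp G f g) h = comp G f (comp G g h)"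
    and ident_arr: "x \<in> obj G \<Longrightarrow> ident G x \<in> arr G"
    and src_ident: "x \<in> obj G \<Longrightarrow> src G (ident G x) = x"
    and tgt_ident: "x \<in> obj G \<Longrightarrow> tgt G (ident G x) = x"
    and comp_ident_left: "f \<in> arr G \<Longrightarrow> comp G (ident G (tgt G f)) f = f"
    and comp_ident_right: "f \<in> arr G \<Longrightarrow> comp G f (ident G (src G f)) = f"
    and invr_arr: "f \<in> arr G \<Longrightarrow> invr G f \<in> arr G"
    and src_invr: "f \<in> arr G \<Longrightarrow> src G (invr G f) = tgt G f"
    and tgt_invr: "f \<in> arr G \<Longrightarrow> tgt G (invr G f) = src G f"
    and invr_left: "f \<in> arr G \<Longrightarrow> comp G (invr G f) f = ident G (src G f)"
    and invr_right: "f \<in> arr G \<Longrightarrow> comp G f (invr G f) = ident G (tgt G f)"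

definition subgroupoid :: "('o, 'a) groupoid_data \<Rightarrow> ('o, 'a) groupoid_data \<Rightarrow> bool" where
  "subgroupoid H G \<longleftrightarrow>
     groupoid H \<and> groupoid G \<and> obj H \<subseteq> obj G \<and> arr H \<subseteq> arr G \<and>
     (\<forall>f \<in> arr H. src H f = src G f \<and> tgt H f = tgt G f \<and> invr H f = invr G f) \<and>
     (\<forall>f \<in> arr H. \<forall>g \<in> arr H. src H f = tgt H g \<longrightarrow> comp H f g = comp G f g) \<and>
     (\<forall>x \<in> obj H. ident H x = ident G x)"

definition connected_groupoid :: "('o, 'a) groupoid_data \<Rightarrow> bool" where
  "connected_groupoid G \<longleftrightarrow>
     groupoid G \<and> (\<forall>x \<in> obj G. \<forall>y \<in> obj G. \<exists>f \<in> arr G. src G f = x \<and> tgt G f = y)"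

definition groupoid_order :: "('o, 'a) groupoid_data \<Rightarrow> nat" where
  "groupoid_order G = card (arr G)"

text \<open>
  A change of basis matrix is tagged with its ordered pair of bases, since different pairs
  may have equal matrices: the arrow \<open>(v, M\<^sub>v\<^sub>t, t)\<close> goes from \<open>t\<close> to \<open>v\<close>,
  as \<open>M\<^sub>v\<^sub>t\<close> turns coordinates with respect to \<open>t\<close> into coordinates with respect to \<open>v\<close>.
  The operations are the actual matrix product and matrix inverse; that they stay among the
  change of basis matrices is part of being a groupoid.
\<close>

type_synonym cob_arrow = "real poly list \<times> real mat \<times> real poly list"

definition arrow_matrix :: "cob_arrow \<Rightarrow> real mat" where
  "arrow_matrix f = fst (snd f)"

definition cob_groupoid :: "real poly list set \<Rightarrow> (real poly list, cob_arrow) groupoid_data" where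
  "cob_groupoid B = \<lparr>
     obj = B,
     arr = {(v, change_of_basis v t, t) | v t. v \<in> B \<and> t \<in> B},
     src = (\<lambda>(v, M, t). t),
     tgt = (\<lambda>(v, M, t). v),
     comp = (\<lambda>(v, M, r) (r', M', t). (v, M * M', t)),
     ident = (\<lambda>v. (v, 1\<^sub>m (length v), v)),
     invr = (\<lambda>(v, M, t). (t, the (mat_inverse M), v))\<rparr>"

end

theory Submission
  imports Defs
begin

text \<open>
  For bases \<open>v\<close>, \<open>r\<close>, \<open>t\<close> of one and the same space, expanding \<open>t ! j\<close> in \<open>r\<close> and then each
  \<open>r ! k\<close> in \<open>v\<close> gives \<open>M\<^sub>v\<^sub>r M\<^sub>r\<^sub>t = M\<^sub>v\<^sub>t\<close>; together with \<open>M\<^sub>v\<^sub>v = 1\<close> this makes \<open>M\<^sub>t\<^sub>v\<close> the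
  inverse of \<open>M\<^sub>v\<^sub>t\<close>. Hence any set \<open>B\<close> of bases of a fixed space carries a groupoid with
  exactly one arrow per ordered pair of bases. Such a groupoid is connected, has \<open>(card B)\<^sup>2\<close>
  arrows, and restricts to a subgroupoid on every subset of \<open>B\<close>. This part of the argument
  is plain linear algebra (\<open>groupoid_cob_groupoid\<close>, \<open>subgroupoid_cob_groupoid\<close>,
  \<open>connected_cob_groupoid\<close>, \<open>groupoid_order_cob_groupoid\<close>).

  The degrees decide the shape of the matrices. The entries of column \<open>j\<close> of \<open>M\<^sub>v\<^sub>t\<close> are the
  scalars \<open>c\<^sub>k\<close> with \<open>t ! j = (\<Sum>k. c\<^sub>k v\<^sub>k)\<close>. In the ascending case, comparing the
  coefficients of \<open>x ^ (m + i * d)\<close> for \<open>i = 0, 1, \<dots>, j - 1\<close> yields a triangular homogeneous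
  system for \<open>c\<^sub>0, \<dots>, c\<^sub>j\<^sub>-\<^sub>1\<close> with nonzero diagonal, because \<open>t ! j\<close> has no coefficients
  below exponent \<open>m + j * d\<close>; so all of them vanish and the matrix is lower triangular. In the
  descending case the same comparison runs from the top exponent downwards. Both are instances
  of forward substitution (\<open>forward_substitution_zero\<close>) with unknowns eliminated in
  increasing or decreasing order of index.
\<close>

section \<open>Forward substitution\<close>

text \<open>
  The order of elimination is given by \<open>rank\<close>, so that the lemma serves both directions:
  the equation at \<open>i\<close> involves, besides the unknown \<open>c i\<close> with its nonzero pivot \<open>a i i\<close>, only
  unknowns eliminated earlier.
\<close>

lemma forward_substitution_zero:
  fixes a :: "'i \<Rightarrow> 'i \<Rightarrow> 'b::idom" and rank :: "'i \<Rightarrow> nat"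
  assumes "finite I" and inj: "inj_on rank I"
    and later: "\<And>i k. \<lbrakk>i \<in> I; k \<in> I; rank i < rank k\<rbrakk> \<Longrightarrow> a i k = 0"
    and pivot: "\<And>i. i \<in> I \<Longrightarrow> a i i \<noteq> 0"
    and eqs: "\<And>i. \<lbrakk>i \<in> I; rank i < b\<rbrakk> \<Longrightarrow> (\<Sum>k\<in>I. c k * a i k) = 0"
    and "i \<in> I" and "rank i < b"
  shows "c i = 0"
  using \<open>i \<in> I\<close> \<open>rank i < b\<close>
proof (induction "rank i" arbitrary: i rule: less_induct)
  case less
  have "c k * a i k = 0" if "k \<in> I - {i}" for k
  proof (cases "rank k < rank i")
    case True
    then show ?thesis using less that by simp
  next
    case False
    then have "rank i < rank k"
      using inj less.prems that by (metis DiffD1 DiffD2 inj_onD linorder_neqE_nat singletonI)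
    then show ?thesis using later less.prems that by simp
  qed
  then have "(\<Sum>k\<in>I. c k * a i k) = c i * a i i"
    using less.prems(1) \<open>finite I\<close> by (simp add: sum.remove sum.neutral)
  then show ?case using eqs less.prems pivot by simp
qed

section \<open>Coordinates with respect to ordered bases\<close>

lemma ordered_basis_same_length:
  assumes "ordered_basis V v" and "ordered_basis V t"
  shows "length v = length t"
proof -
  have "length v = real_poly.dim V" if "ordered_basis V v" for v
    using that unfolding ordered_basis_def
    by (metis distinct_card real_poly.dim_eq_card real_poly.span_span)
  then show ?thesis using assms by metis
qed

lemma ordered_basis_nth_mem:
  assumes "ordered_basis V t" and "j < length t"
  shows "t ! j \<in> V"
  using assms unfolding ordered_basis_def
  by (metis nth_mem real_poly.span_base)

lemma ordered_basis_nth_nonzero: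
  assumes "ordered_basis V v" and "i < length v"
  shows "v ! i \<noteq> 0"
  using assms unfolding ordered_basis_def
  by (metis nth_mem real_poly.dependent_zero)

lemma sum_coordinates:
  assumes v: "ordered_basis V v" and "p \<in> V"
  shows "(\<Sum>k<length v. Polynomial.smult (real_poly.representation (set v) p (v ! k)) (v ! k)) = p"
proof -
  have bij: "bij_betw ((!) v) {..<length v} (set v)"
    using v by (simp add: bij_betw_nth ordered_basis_def)
  have "(\<Sum>b\<in>set v. Polynomial.smult (real_poly.representation (set v) p b) b) = p"
    using assms by (intro real_poly.sum_representation_eq) (auto simp: ordered_basis_def)
  then show ?thesis
    using sum.reindex_bij_betw
      [OF bij, where g = "\<lambda>b. Polynomial.smult (real_poly.representation (set v) p b) b"] by simp
qed

lemma change_of_basis_carrier: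
  "change_of_basis v t \<in> carrier_mat (length v) (length t)"
  by (simp add: change_of_basis_def)

lemma change_of_basis_self:
  assumes "ordered_basis V v"
  shows "change_of_basis v v = 1\<^sub>m (length v)"
  using assms unfolding change_of_basis_def ordered_basis_def
  by (intro eq_matI) (auto simp: real_poly.representation_basis nth_eq_iff_index_eq)

text \<open>
  Taking coordinates with respect to \<open>v\<close> is linear, so it may be applied termwise to the
  expansion of \<open>t ! j\<close> in \<open>r\<close>; the result is the matrix product.
\<close>

lemma change_of_basis_mult:
  assumes v: "ordered_basis V v" and r: "ordered_basis V r" and t: "ordered_basis V t"
  shows "change_of_basis v r * change_of_basis r t = change_of_basis v t"
proof (rule eq_matI)
  fix i j assume "i < dim_row (change_of_basis v t)" "j < dim_col (change_of_basis v t)"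
  then have ij: "i < length v" "j < length t" by (simp_all add: change_of_basis_def)
  let ?R = "real_poly.representation"
  let ?c = "\<lambda>k. ?R (set r) (t ! j) (r ! k)"
  have indep: "real_poly.independent (set v)" and span: "real_poly.span (set v) = V"
    using v by (auto simp: ordered_basis_def)
  have mem: "r ! k \<in> real_poly.span (set v)" if "k < length r" for k
    using ordered_basis_nth_mem[OF r that] span by simp
  have "?R (set v) (t ! j) = ?R (set v) (\<Sum>k<length r. Polynomial.smult (?c k) (r ! k))"
    using sum_coordinates[OF r ordered_basis_nth_mem[OF t ij(2)]] by simp
  also have "\<dots> = (\<lambda>b. \<Sum>k<length r. ?R (set v) (Polynomial.smult (?c k) (r ! k)) b)"
    using indep mem by (intro real_poly.representation_sum) (auto intro: real_poly.span_scale)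
  also have "\<dots> = (\<lambda>b. \<Sum>k<length r. ?c k * ?R (set v) (r ! k) b)"
    using indep mem by (intro ext sum.cong) (auto simp: real_poly.representation_scale)
  finally have "?R (set v) (t ! j) (v ! i) = (\<Sum>k<length r. ?c k * ?R (set v) (r ! k) (v ! i))"
    by simp
  then show "(change_of_basis v r * change_of_basis r t) $$ (i, j) = change_of_basis v t $$ (i, j)"
    using ij
    by (simp add: change_of_basis_def scalar_prod_def lessThan_atLeast0 mult.commute)
qed (simp_all add: change_of_basis_def)

text \<open>
  Both products of \<open>M\<^sub>v\<^sub>t\<close> and \<open>M\<^sub>t\<^sub>v\<close> are identities, so Gauss--Jordan elimination succeeds on
  \<open>M\<^sub>v\<^sub>t\<close>, and what it returns is \<open>M\<^sub>t\<^sub>v\<close> because inverses are unique.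
\<close>

lemma mat_inverse_change_of_basis:
  assumes v: "ordered_basis V v" and t: "ordered_basis V t"
  shows "the (mat_inverse (change_of_basis v t)) = change_of_basis t v"
proof -
  let ?n = "length v" and ?A = "change_of_basis v t" and ?B = "change_of_basis t v"
  have A: "?A \<in> carrier_mat ?n ?n" and B: "?B \<in> carrier_mat ?n ?n"
    using change_of_basis_carrier[of v t] change_of_basis_carrier[of t v]
      ordered_basis_same_length[OF v t] by simp_all
  have AB: "?A * ?B = 1\<^sub>m ?n"
    using change_of_basis_mult[OF v t v] change_of_basis_self[OF v] by simp
  have BA: "?B * ?A = 1\<^sub>m ?n"
    using change_of_basis_mult[OF t v t] change_of_basis_self[OF t]
      ordered_basis_same_length[OF v t] by simp
  have "?A \<in> Units (ring_mat TYPE(real) ?n ())"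
    using A B AB BA by (auto simp: Units_def ring_mat_def)
  then obtain C where C: "mat_inverse ?A = Some C"
    using mat_inverse(1)[OF A, where b = "()"] by (cases "mat_inverse ?A") auto
  then have CA: "C * ?A = 1\<^sub>m ?n" and "C \<in> carrier_mat ?n ?n"
    using mat_inverse(2)[OF A C] by auto
  then have "C = C * (?A * ?B)" using AB by simp
  also have "\<dots> = ?B"
    using CA A B \<open>C \<in> carrier_mat ?n ?n\<close> by (simp flip: assoc_mult_mat)
  finally show ?thesis using C by simp
qed

section \<open>The groupoid on a set of bases of one space\<close>

text \<open>
  Rewriting with the three equations below turns every composite, identity and inverse back
  into a change of basis matrix for its source and target; since there is one arrow per
  ordered pair, the groupoid laws then hold by comparing endpoints.
\<close>

lemma groupoid_cob_groupoid:
  assumes B: "\<And>v. v \<in> B \<Longrightarrow> ordered_basis V v"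
  shows "groupoid (cob_groupoid B)"
proof -
  have mult: "change_of_basis v r * change_of_basis r t = change_of_basis v t"
    if "v \<in> B" "r \<in> B" "t \<in> B" for v r t
    using change_of_basis_mult B that by blast
  have self: "1\<^sub>m (length v) = change_of_basis v v" if "v \<in> B" for v
    using change_of_basis_self[OF B[OF that]] by simp
  have inverse: "the (mat_inverse (change_of_basis v t)) = change_of_basis t v"
    if "v \<in> B" "t \<in> B" for v t
    using mat_inverse_change_of_basis B that by blast
  show ?thesis
    by (rule groupoid.intro; clarsimp simp: cob_groupoid_def; simp add: mult self inverse)
qed

lemma subgroupoid_cob_groupoid:
  assumes "\<And>v. v \<in> B \<Longrightarrow> ordered_basis V v" and "C \<subseteq> B"
  shows "subgroupoid (cob_groupoid C) (cob_groupoid B)"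
proof -
  have "groupoid (cob_groupoid C)" "groupoid (cob_groupoid B)"
    using assms by (auto intro: groupoid_cob_groupoid)
  then show ?thesis
    using \<open>C \<subseteq> B\<close> by (auto simp: subgroupoid_def cob_groupoid_def)
qed

lemma connected_cob_groupoid:
  assumes "\<And>v. v \<in> B \<Longrightarrow> ordered_basis V v"
  shows "connected_groupoid (cob_groupoid B)"
  using groupoid_cob_groupoid[OF assms]
  by (auto simp: connected_groupoid_def cob_groupoid_def)

text \<open>
  The endpoints are part of an arrow, so distinct pairs of bases give distinct arrows even
  when their matrices coincide.
\<close>

lemma groupoid_order_cob_groupoid:
  "groupoid_order (cob_groupoid B) = (card B)\<^sup>2"
proof -
  have "arr (cob_groupoid B) = (\<lambda>(v, t). (v, change_of_basis v t, t)) ` (B \<times> B)"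
    by (auto simp: cob_groupoid_def)
  moreover have "inj_on (\<lambda>(v, t). (v, change_of_basis v t, t)) (B \<times> B)"
    by (auto simp: inj_on_def)
  ultimately show ?thesis
    by (simp add: groupoid_order_def card_image card_cartesian_product power2_eq_square)
qed

section \<open>Triangularity\<close>

lemma coeff_min_degree:
  assumes "p \<noteq> 0"
  shows "coeff p (min_degree p) \<noteq> 0"
proof -
  obtain i where "coeff p i \<noteq> 0"
    using assms by (auto simp: poly_eq_iff)
  then show ?thesis
    unfolding min_degree_def by (rule LeastI)
qed

lemma coeff_less_min_degree:
  assumes "i < min_degree p"
  shows "coeff p i = 0"
  using assms not_less_Least unfolding min_degree_def by blast

text \<open>
  Forward substitution applied to one column of \<open>M\<^sub>v\<^sub>t\<close>: the exponents \<open>e i\<close> at which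
  coefficients are compared index the equations.
\<close>

lemma change_of_basis_entry_zero:
  assumes v: "ordered_basis V v" and t: "ordered_basis V t"
    and inj: "inj_on rank {..<length v}"
    and later: "\<And>i k. \<lbrakk>i < length v; k < length v; rank i < rank k\<rbrakk> \<Longrightarrow> coeff (v ! k) (e i) = 0"
    and pivot: "\<And>i. i < length v \<Longrightarrow> coeff (v ! i) (e i) \<noteq> 0"
    and eqs: "\<And>i. \<lbrakk>i < length v; rank i < rank j\<rbrakk> \<Longrightarrow> coeff (t ! j) (e i) = 0"
    and i: "i < length v" and j: "j < length t" and "rank i < (rank j :: nat)"
  shows "change_of_basis v t $$ (i, j) = 0"
proof -
  let ?c = "\<lambda>k. real_poly.representation (set v) (t ! j) (v ! k)"
  have "(\<Sum>k<length v. ?c k * coeff (v ! k) l) = coeff (t ! j) l" for l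
    using arg_cong[where f = "\<lambda>p. coeff p l",
        OF sum_coordinates[OF v ordered_basis_nth_mem[OF t j]]]
    by (simp add: coeff_sum)
  then have "?c i = 0"
    using forward_substitution_zero
      [where I = "{..<length v}" and rank = rank and a = "\<lambda>i k. coeff (v ! k) (e i)"
        and b = "rank j" and c = ?c and i = i]
      inj later pivot eqs i \<open>rank i < rank j\<close> by simp
  then show ?thesis using i j by (simp add: change_of_basis_def)
qed

lemma lower_triangular_ascending:
  assumes "0 < d" and v: "ascending_basis m n d v" and t: "ascending_basis m n d t"
  shows "lower_triangular (change_of_basis v t)"
proof -
  let ?V = "poly_space m n d"
  have vb: "ordered_basis ?V v" and tb: "ordered_basis ?V t"
    and vdeg: "\<And>i. i < length v \<Longrightarrow> min_degree (v ! i) = m + i * d"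
    and tdeg: "\<And>i. i < length t \<Longrightarrow> min_degree (t ! i) = m + i * d"
    using v t by (auto simp: ascending_basis_def)
  have "change_of_basis v t $$ (i, j) = 0" if "i < length v" "j < length t" "i < j" for i j
  proof (rule change_of_basis_entry_zero[OF vb tb, where rank = "\<lambda>i. i" and e = "\<lambda>i. m + i * d"])
    show "coeff (v ! k) (m + i * d) = 0" if "i < length v" "k < length v" "i < k" for i k
      using coeff_less_min_degree vdeg that \<open>0 < d\<close> by simp
    show "coeff (v ! i) (m + i * d) \<noteq> 0" if "i < length v" for i
      using coeff_min_degree[OF ordered_basis_nth_nonzero[OF vb that]] vdeg[OF that] by simp
    show "coeff (t ! j) (m + i * d) = 0" if "i < length v" "i < j" for i
      using coeff_less_min_degree tdeg that \<open>j < length t\<close> \<open>0 < d\<close> by simp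
  qed (use that in auto)
  then show ?thesis by (simp add: lower_triangular_def change_of_basis_def)
qed

lemma upper_triangular_descending:
  assumes "0 < d" and v: "descending_basis m n d v" and t: "descending_basis m n d t"
  shows "upper_triangular (change_of_basis v t)"
proof -
  let ?V = "poly_space m n d"
  have vb: "ordered_basis ?V v" and tb: "ordered_basis ?V t" and len: "length t = length v"
    and vdeg: "\<And>i. i < length v \<Longrightarrow> degree (v ! i) = m + i * d"
    and tdeg: "\<And>i. i < length t \<Longrightarrow> degree (t ! i) = m + i * d"
    using v t by (auto simp: descending_basis_def)
  have "change_of_basis v t $$ (i, j) = 0" if "i < length v" "j < length t" "j < i" for i j
  \<comment> \<open>Subtracting from the length reverses the order of elimination.\<close>
  proof (rule change_of_basis_entry_zero
      [OF vb tb, where rank = "\<lambda>i. length v - i" and e = "\<lambda>i. m + i * d"])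
    show "coeff (v ! k) (m + i * d) = 0"
      if "i < length v" "k < length v" "length v - i < length v - k" for i k
      using that \<open>0 < d\<close> by (intro coeff_eq_0) (simp add: vdeg)
    show "coeff (v ! i) (m + i * d) \<noteq> 0" if "i < length v" for i
      using leading_coeff_neq_0[OF ordered_basis_nth_nonzero[OF vb that]] vdeg[OF that] by simp
    show "coeff (t ! j) (m + i * d) = 0" if "i < length v" "length v - i < length v - j" for i
      using that \<open>j < length t\<close> \<open>0 < d\<close> by (intro coeff_eq_0) (simp add: tdeg)
    show "inj_on (\<lambda>i. length v - i) {..<length v}"
      by (auto simp: inj_on_def)
  qed (use that len in auto)
  then show ?thesis by (auto simp: upper_triangular_def change_of_basis_def len)
qed

theorem theorem2:
  fixes m n d k1 k2 :: nat and S :: "real poly list set"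
  assumes "m \<le> n"
    and "d \<in> {1, 2}"
    and "d = 2 \<Longrightarrow> even n \<longleftrightarrow> even m"
    and "finite S"
    and "\<And>v. v \<in> S \<Longrightarrow> ascending_basis m n d v \<or> descending_basis m n d v"
    and "k1 = card {v \<in> S. ascending_basis m n d v}"
    and "k2 = card {v \<in> S. descending_basis m n d v}"
  shows "groupoid (cob_groupoid S) \<and>
    (let A = cob_groupoid {v \<in> S. ascending_basis m n d v} in
      subgroupoid A (cob_groupoid S) \<and> connected_groupoid A \<and> groupoid_order A = k1\<^sup>2 \<and>
      (\<forall>f \<in> arr A. lower_triangular (arrow_matrix f))) \<and>
    (let D = cob_groupoid {v \<in> S. descending_basis m n d v} in
      subgroupoid D (cob_groupoid S) \<and> connected_groupoid D \<and> groupoid_order D = k2\<^sup>2 \<and>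
      (\<forall>f \<in> arr D. upper_triangular (arrow_matrix f)))"
proof -
  let ?A = "{v \<in> S. ascending_basis m n d v}" and ?D = "{v \<in> S. descending_basis m n d v}"
  have "0 < d" using assms(2) by auto
  have basis: "ordered_basis (poly_space m n d) v" if "v \<in> S" for v
    using assms(5)[OF that] by (auto simp: ascending_basis_def descending_basis_def)
  have "\<forall>f \<in> arr (cob_groupoid ?A). lower_triangular (arrow_matrix f)"
    using lower_triangular_ascending[OF \<open>0 < d\<close>] by (auto simp: cob_groupoid_def arrow_matrix_def)
  moreover have "\<forall>f \<in> arr (cob_groupoid ?D). upper_triangular (arrow_matrix f)"
    using upper_triangular_descending[OF \<open>0 < d\<close>] by (auto simp: cob_groupoid_def arrow_matrix_def)
  moreover have "subgroupoid (cob_groupoid ?A) (cob_groupoid S)"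
    "subgroupoid (cob_groupoid ?D) (cob_groupoid S)"
    using subgroupoid_cob_groupoid[OF basis] by simp_all
  moreover have "connected_groupoid (cob_groupoid ?A)" "connected_groupoid (cob_groupoid ?D)"
    using basis by (auto intro: connected_cob_groupoid)
  ultimately show ?thesis
    using groupoid_cob_groupoid[OF basis] assms(6,7)
    by (simp add: Let_def groupoid_order_cob_groupoid)
qed

end
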